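(* Let $r\ge 1$. Let $X$ be a simplicial complex in which every $(r-1)$-dimensional simplex is contained in exactly one $r$-dimensional simplex. Then, for all $1\le k\le f_{r-1}(X)/(r+1)$, \[ \sum_{i=1}^k \lambda_i(L_{r-1}^+(X)) = (r+1)k = \sum_{i=1}^{(r+1)k} d_i^{(r)}(X). \]
   Context: A simplicial complex $X$ on a finite vertex set $V$ is a family of subsets of $V$ closed under inclusion; its elements are called simplices (or faces), $\dim(\sigma)=|\sigma|-1$ for $\sigma\in X$, and $\dim(X)$ is the maximal dimension of a simplex. $X(i)$ is the set of $i$-dimensional simplices (with $X(-1)=\{\emptyset\}$) and $f_i(X)=|X(i)|$. For $\sigma\in X$ and $1\le r\le\dim(X)$, the $r$-degree $\deg_X^{(r)}(\sigma)$ is the number of $r$-dimensional simplices of $X$ containing $\sigma$. For $1\le i\le f_{r-1}(X)$, $d_i^{(r)}(X)$ is the $i$-th largest (with multiplicity) $r$-degree of a simplex in $X(r-1)$. Fix an arbitrary linear order $<$ on $V$. For $\sigma\in X(s-1)$, $\tau\in X(s)$ with $\sigma\subset\tau$ ($0\le s\le \dim(X)$), let $u$ be the unique vertex of $\tau\setminus\sigma$ and set $(\tau:\sigma)=(-1)^{|\{v\in\tau:\,v<u\}|}$. For $1\le r\le\dim(X)$, the upper Laplacian $L_{r-1}^+(X)\in\mathbb{R}^{f_{r-1}(X)\times f_{r-1}(X)}$ is the matrix indexed by $X(r-1)$ with $L_{r-1}^+(X)_{\tau,\tau}=\deg_X^{(r)}(\tau)$; $L_{r-1}^+(X)_{\tau,\eta}=-(\tau:\tau\cap\eta)(\eta:\tau\cap\eta)$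 if $|\tau\cap\eta|=r-1$ and $\tau\cup\eta\in X$; and all other entries $0$. For a symmetric real matrix $M$, $\lambda_i(M)$ is its $i$-th largest eigenvalue (with multiplicity). *)

theory Defs
  imports "Jordan_Normal_Form.Char_Poly"
begin

(* A point of V need not be a vertex of X, and the void family is not excluded. *)
definition simplicial_complex :: "'a set \<Rightarrow> 'a set set \<Rightarrow> bool" where
  "simplicial_complex V X \<longleftrightarrow>
     finite V \<and> X \<subseteq> Pow V \<and> (\<forall>\<sigma>\<in>X. \<forall>\<tau>. \<tau> \<subseteq> \<sigma> \<longrightarrow> \<tau> \<in> X)"

(* Integer-valued, so that the empty simplex has dimension -1. *)
definition simplex_dim :: "'a set \<Rightarrow> int" where
  "simplex_dim \<sigma> = int (card \<sigma>) - 1"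

definition faces :: "'a set set \<Rightarrow> int \<Rightarrow> 'a set set" where
  "faces X i = {\<sigma> \<in> X. simplex_dim \<sigma> = i}"

definition f_number :: "'a set set \<Rightarrow> int \<Rightarrow> nat" where
  "f_number X i = card (faces X i)"

definition r_degree :: "'a set set \<Rightarrow> nat \<Rightarrow> 'a set \<Rightarrow> nat" where
  "r_degree X r \<sigma> = card {\<tau> \<in> faces X (int r). \<sigma> \<subseteq> \<tau>}"

(* Counted with multiplicity and starting from i = 1; meaningful only for 1 <= i <= size A. *)
definition ith_largest :: "'b::linorder multiset \<Rightarrow> nat \<Rightarrow> 'b" where
  "ith_largest A i = rev (sorted_list_of_multiset A) ! (i - 1)"

definition degree_seq :: "'a set set \<Rightarrow> nat \<Rightarrow> nat \<Rightarrow> nat" where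
  "degree_seq X r i =
     ith_largest (image_mset (r_degree X r) (mset_set (faces X (int r - 1)))) i"

(* (tau : sigma). The relation R is the reflexive version of the order on the vertices;
   sigma is tau with one vertex removed. *)
definition incidence_sign :: "'a rel \<Rightarrow> 'a set \<Rightarrow> 'a set \<Rightarrow> real" where
  "incidence_sign R \<tau> \<sigma> =
     (let u = the_elem (\<tau> - \<sigma>) in (- 1) ^ card {v \<in> \<tau>. (v, u) \<in> R \<and> v \<noteq> u})"

definition upper_laplacian_entry ::
    "'a rel \<Rightarrow> 'a set set \<Rightarrow> nat \<Rightarrow> 'a set \<Rightarrow> 'a set \<Rightarrow> real" where
  "upper_laplacian_entry R X r \<tau> \<eta> =
     (if \<tau> = \<eta> then real (r_degree X r \<tau>)
      else if int (card (\<tau> \<inter> \<eta>)) = int r - 1 \<and> \<tau> \<union> \<eta> \<in> X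
      then - incidence_sign R \<tau> (\<tau> \<inter> \<eta>) * incidence_sign R \<eta> (\<tau> \<inter> \<eta>)
      else 0)"

(* The matrix L^+_{r-1}(X). Its rows and columns are indexed by the (r-1)-simplices through
   a list xs that enumerates them without repetition. *)
definition upper_laplacian ::
    "'a rel \<Rightarrow> 'a set set \<Rightarrow> nat \<Rightarrow> 'a set list \<Rightarrow> real mat" where
  "upper_laplacian R X r xs =
     mat (length xs) (length xs) (\<lambda>(i, j). upper_laplacian_entry R X r (xs ! i) (xs ! j))"

(* Eigenvalues with multiplicity are the real roots of the characteristic polynomial. For a
   symmetric n x n matrix there are n of them, and algebraic and geometric multiplicities agree. *)
definition ith_eigenvalue :: "real mat \<Rightarrow> nat \<Rightarrow> real" where
  "ith_eigenvalue M i = ith_largest (proots (char_poly M)) i"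

end

theory Submission
  imports Defs
begin

text \<open>
  For the boundary matrix \<open>C\<close> from \<open>r\<close>-chains to \<open>(r-1)\<close>-chains, the upper Laplacian is
  \<open>C C\<^sup>T\<close>. If no two \<open>r\<close>-simplices share a facet, the columns of \<open>C\<close> are orthogonal and
  \<open>C\<^sup>T C = (r+1) I\<close>. Since \<open>C C\<^sup>T\<close> and \<open>C\<^sup>T C\<close> have the same characteristic polynomial up to a
  power of the indeterminate, the nonzero eigenvalues are all \<open>r+1\<close>, one for each \<open>r\<close>-simplex.
  Every \<open>(r-1)\<close>-simplex has degree 1 and \<open>f\<^sub>r\<^sub>-\<^sub>1 = (r+1) f\<^sub>r\<close>, so the range of \<open>k\<close> never reaches
  the zero eigenvalues.
\<close>

section \<open>Characteristic polynomials of AB and BA\<close>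

text \<open>Both sides equal \<open>x ^ m * det M\<close> for one block matrix \<open>M\<close>:
  multiplying by \<open>P\<close> on the right or by \<open>Q\<close> on the left clears its lower
  left block and leaves \<open>A * B\<close> or \<open>B * A\<close> on the diagonal. Keeping powers
  of \<open>x\<close> on both sides avoids division, so \<open>x\<close> may be a polynomial
  indeterminate.\<close>

lemma Sylvester_det:
  fixes A B :: "'a :: idom mat"
  assumes A: "A \<in> carrier_mat n m" and B: "B \<in> carrier_mat m n"
  shows "x ^ m * det (x \<cdot>\<^sub>m 1\<^sub>m n - A * B) = x ^ n * det (x \<cdot>\<^sub>m 1\<^sub>m m - B * A)"
proof -
  define M where "M = four_block_mat (x \<cdot>\<^sub>m 1\<^sub>m n) A B (1\<^sub>m m)"
  define P where "P = four_block_mat (1\<^sub>m n) (0\<^sub>m n m) (- B) (1\<^sub>m m)"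
  \<comment> \<open>The corner \<open>x \<cdot>\<^sub>m 1\<^sub>m m\<close>, in place of the
    identity used in \<open>P\<close>, makes the lower left block of \<open>Q * M\<close> equal to
    \<open>- x B + x B = 0\<close>; its price is \<open>det Q = x ^ m\<close>.\<close>
  define Q where "Q = four_block_mat (1\<^sub>m n) (0\<^sub>m n m) (- B) (x \<cdot>\<^sub>m 1\<^sub>m m)"
  have M: "M \<in> carrier_mat (n + m) (n + m)" and P: "P \<in> carrier_mat (n + m) (n + m)"
    and Q: "Q \<in> carrier_mat (n + m) (n + m)"
    unfolding M_def P_def Q_def by (rule four_block_carrier_mat; simp)+
  have XAB: "x \<cdot>\<^sub>m 1\<^sub>m n - A * B \<in> carrier_mat n n" and XBA: "x \<cdot>\<^sub>m 1\<^sub>m m - B * A \<in> carrier_mat m m"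
    using A B by (auto intro!: minus_carrier_mat)
  have "M * P = four_block_mat (x \<cdot>\<^sub>m 1\<^sub>m n - A * B) A (0\<^sub>m m n) (1\<^sub>m m)"
    unfolding M_def P_def using A B
    by (subst mult_four_block_mat[of _ n n _ m _ m _ _ n _ m])
       (auto simp: mult_smult_assoc_mat[of _ n n] add_uminus_minus_mat[of _ n n]
         intro!: cong_four_block_mat)
  then have "det M * det P = det (x \<cdot>\<^sub>m 1\<^sub>m n - A * B)"
    using det_four_block_mat_lower_left_zero[OF XAB A refl one_carrier_mat]
    by (simp add: det_mult[OF M P, symmetric])
  moreover have "det P = 1"
    unfolding P_def using B by (simp add: det_four_block_mat_upper_right_zero[where n = n and m = m])
  moreover have "Q * M = four_block_mat (x \<cdot>\<^sub>m 1\<^sub>m n) A (0\<^sub>m m n) (x \<cdot>\<^sub>m 1\<^sub>m m - B * A)"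
  proof -
    have "- B * (x \<cdot>\<^sub>m 1\<^sub>m n) + x \<cdot>\<^sub>m 1\<^sub>m m * B = 0\<^sub>m m n"
      using B by (simp add: mult_smult_assoc_mat[of _ m m] mult_smult_distrib[of _ m n])
        (intro eq_matI, auto)
    moreover have "- B * A + x \<cdot>\<^sub>m 1\<^sub>m m * 1\<^sub>m m = x \<cdot>\<^sub>m 1\<^sub>m m - B * A"
      using A B by (intro eq_matI) auto
    ultimately show ?thesis
      unfolding M_def Q_def using A B
      by (subst mult_four_block_mat[of _ n n _ m _ m _ _ n _ m]) auto
  qed
  then have "det Q * det M = x ^ n * det (x \<cdot>\<^sub>m 1\<^sub>m m - B * A)"
    using det_four_block_mat_lower_left_zero[OF _ A refl XBA, of "x \<cdot>\<^sub>m 1\<^sub>m n"]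
    by (simp add: det_mult[OF Q M, symmetric])
  moreover have "det Q = x ^ m"
    unfolding Q_def using B by (simp add: det_four_block_mat_upper_right_zero[where n = n and m = m])
  ultimately show ?thesis by simp
qed

lemma char_poly_matrix_eq_minus:
  fixes A :: "'a :: idom mat"
  assumes "A \<in> carrier_mat n n"
  shows "char_poly_matrix A = [:0, 1:] \<cdot>\<^sub>m 1\<^sub>m n - map_mat (\<lambda>a. [:a:]) A"
  using assms unfolding char_poly_matrix_def by (intro eq_matI) auto

text \<open>This is \<open>Sylvester_det\<close> over the polynomial ring, with the indeterminate
  for \<open>x\<close> and the entries of \<open>A\<close> and \<open>B\<close> embedded as constant
  polynomials; the embedding is a homomorphism, hence commutes with matrix products.\<close>

lemma char_poly_mult_commute:
  fixes A B :: "'a :: idom mat"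
  assumes A: "A \<in> carrier_mat n m" and B: "B \<in> carrier_mat m n"
  shows "[:0, 1:] ^ m * char_poly (A * B) = [:0, 1:] ^ n * char_poly (B * A)"
proof -
  have hom: "semiring_hom (\<lambda>a :: 'a. [:a:])"
    by unfold_locales (auto simp: one_pCons)
  have "A * B \<in> carrier_mat n n" "B * A \<in> carrier_mat m m"
    using A B by auto
  then show ?thesis
    unfolding char_poly_def
    using Sylvester_det[of "map_mat (\<lambda>a. [:a:]) A" n m "map_mat (\<lambda>a. [:a:]) B" "[:0, 1:]"] A B
    by (simp add: char_poly_matrix_eq_minus[where n = n] char_poly_matrix_eq_minus[where n = m]
      semiring_hom.mat_hom_mult[OF hom A B] semiring_hom.mat_hom_mult[OF hom B A])
qed

lemma char_poly_smult_one:
  fixes c :: "'a :: idom"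
  shows "char_poly (c \<cdot>\<^sub>m 1\<^sub>m n) = [:- c, 1:] ^ n"
proof -
  have "char_poly_matrix (c \<cdot>\<^sub>m 1\<^sub>m n) = [:- c, 1:] \<cdot>\<^sub>m 1\<^sub>m n"
    unfolding char_poly_matrix_def by (intro eq_matI) auto
  then show ?thesis unfolding char_poly_def by simp
qed

text \<open>The small Gram matrix is scalar, so its characteristic polynomial is explicit. Since
  \<open>m \<le> n\<close>, the factor \<open>[:0, 1:] ^ m\<close> can be cancelled in the integral
  domain of polynomials, and \<open>n - m\<close> zero roots remain.\<close>

lemma proots_char_poly_mult_transpose:
  fixes C :: "'a :: idom mat"
  assumes C: "C \<in> carrier_mat n m" and CC: "transpose_mat C * C = c \<cdot>\<^sub>m 1\<^sub>m m" and "m \<le> n"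
  shows "proots (char_poly (C * transpose_mat C)) = replicate_mset m c + replicate_mset (n - m) 0"
proof -
  have "[:0, 1:] ^ m * char_poly (C * transpose_mat C) = [:0, 1:] ^ n * [:- c, 1:] ^ m"
    using char_poly_mult_commute[OF C, of "transpose_mat C"] C
    by (simp add: CC char_poly_smult_one)
  also have "\<dots> = [:0, 1:] ^ m * ([:0, 1:] ^ (n - m) * [:- c, 1:] ^ m)"
    using \<open>m \<le> n\<close> by (simp add: power_add[symmetric] mult.assoc[symmetric])
  finally have "char_poly (C * transpose_mat C) = [:0, 1:] ^ (n - m) * [:- c, 1:] ^ m"
    by simp
  then show ?thesis
    by (simp add: proots_mult proots_power)
qed

section \<open>Sorted multisets\<close>

text \<open>Serves both sides of the theorem: the spectrum has the blocks \<open>r + 1\<close> and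
  \<open>0\<close>, and the degrees form a single block.\<close>

lemma ith_largest_two_blocks:
  fixes a b :: "'b :: linorder"
  assumes "b \<le> a" "1 \<le> i" "i \<le> m"
  shows "ith_largest (replicate_mset m a + replicate_mset l b) i = a"
proof -
  \<comment> \<open>Sorting is ascending, so the copies of \<open>b\<close> come first here; the
    \<open>rev\<close> in \<open>ith_largest\<close> then moves the copies of \<open>a\<close> to
    positions \<open>0\<close> to \<open>m - 1\<close>.\<close>
  have "sorted_list_of_multiset (replicate_mset m a + replicate_mset l b)
      = sort (replicate l b @ replicate m a)"
    by (simp add: union_commute flip: sorted_list_of_multiset_mset)
  also have "\<dots> = replicate l b @ replicate m a"
    using \<open>b \<le> a\<close> by (intro sorted_sort_id) (auto simp: sorted_append)
  finally show ?thesis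
    using assms unfolding ith_largest_def by (auto simp: nth_append)
qed

section \<open>The upper Laplacian as a Gram matrix\<close>

lemma incidence_sign_remove:
  assumes "u \<in> \<tau>"
  shows "incidence_sign R \<tau> (\<tau> - {u}) = (- 1) ^ card {v \<in> \<tau>. (v, u) \<in> R \<and> v \<noteq> u}"
proof -
  have "\<tau> - (\<tau> - {u}) = {u}" using assms by auto
  then show ?thesis by (simp add: incidence_sign_def)
qed

lemma incidence_sign_square:
  "incidence_sign R \<tau> \<sigma> * incidence_sign R \<tau> \<sigma> = 1"
  by (simp add: incidence_sign_def Let_def flip: power_add)

text \<open>When \<open>a\<close> precedes \<open>b\<close>, deleting \<open>b\<close> leaves the
  number of predecessors of \<open>a\<close> unchanged, while deleting \<open>a\<close> lowers that
  of \<open>b\<close> by one. Exactly one of the two signs flips.\<close>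

lemma incidence_sign_exchange_ordered:
  assumes fin: "finite \<rho>" and ab: "a \<in> \<rho>" "b \<in> \<rho>" "a \<noteq> b"
    and R: "(a, b) \<in> R" "(b, a) \<notin> R"
  shows "incidence_sign R \<rho> (\<rho> - {a}) * incidence_sign R \<rho> (\<rho> - {b})
    = - (incidence_sign R (\<rho> - {a}) (\<rho> - {a, b}) * incidence_sign R (\<rho> - {b}) (\<rho> - {a, b}))"
proof -
  have eqs: "\<rho> - {a, b} = (\<rho> - {a}) - {b}" "\<rho> - {a, b} = (\<rho> - {b}) - {a}" by auto
  have "{v \<in> \<rho>. (v, b) \<in> R \<and> v \<noteq> b} = insert a {v \<in> \<rho> - {a}. (v, b) \<in> R \<and> v \<noteq> b}"
    using ab R by auto
  then have cb: "card {v \<in> \<rho>. (v, b) \<in> R \<and> v \<noteq> b} = Suc (card {v \<in> \<rho> - {a}. (v, b) \<in> R \<and> v \<noteq> b})"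
    using fin by simp
  have ca: "{v \<in> \<rho>. (v, a) \<in> R \<and> v \<noteq> a} = {v \<in> \<rho> - {b}. (v, a) \<in> R \<and> v \<noteq> a}"
    using R by auto
  have "incidence_sign R \<rho> (\<rho> - {a}) = incidence_sign R (\<rho> - {b}) (\<rho> - {a, b})"
    unfolding eqs(2) using ab ca by (simp add: incidence_sign_remove)
  moreover have "incidence_sign R \<rho> (\<rho> - {b}) = - incidence_sign R (\<rho> - {a}) (\<rho> - {a, b})"
    unfolding eqs(1) using ab cb by (simp add: incidence_sign_remove)
  ultimately show ?thesis by simp
qed

text \<open>The sign identity behind the vanishing of the square of the boundary map.\<close>

lemma incidence_sign_exchange:
  assumes "finite \<rho>" "total_on \<rho> R" "antisym R" "a \<in> \<rho>" "b \<in> \<rho>" "a \<noteq> b"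
  shows "incidence_sign R \<rho> (\<rho> - {a}) * incidence_sign R \<rho> (\<rho> - {b})
    = - (incidence_sign R (\<rho> - {a}) (\<rho> - {a, b}) * incidence_sign R (\<rho> - {b}) (\<rho> - {a, b}))"
proof (cases "(a, b) \<in> R")
  case True
  then have "(b, a) \<notin> R" using assms by (auto dest: antisymD)
  with True assms show ?thesis by (intro incidence_sign_exchange_ordered)
next
  case False
  then have "(b, a) \<in> R" using assms by (auto simp: total_on_def)
  with False show ?thesis
    using incidence_sign_exchange_ordered[of \<rho> b a R] assms by (simp add: mult.commute insert_commute)
qed

lemma faces_iff_card:
  shows "\<sigma> \<in> faces X (int r - 1) \<longleftrightarrow> \<sigma> \<in> X \<and> card \<sigma> = r"
    and "\<sigma> \<in> faces X (int r) \<longleftrightarrow> \<sigma> \<in> X \<and> card \<sigma> = Suc r"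
  by (auto simp: faces_def simplex_dim_def)

lemma finite_faces:
  assumes "simplicial_complex V X"
  shows "finite (faces X i)"
proof (rule finite_subset)
  show "faces X i \<subseteq> Pow V" using assms by (auto simp: simplicial_complex_def faces_def)
  show "finite (Pow V)" using assms by (simp add: simplicial_complex_def)
qed

text \<open>For \<sigma> of size \<open>r\<close> and \<rho> of size \<open>r + 1\<close>, inclusion
  makes \<sigma> a facet of \<rho>; outside such pairs \<open>incidence_sign\<close> carries no
  meaning, hence the guard.\<close>

definition boundary_entry :: "'a rel \<Rightarrow> 'a set \<Rightarrow> 'a set \<Rightarrow> real" where
  "boundary_entry R \<sigma> \<rho> = (if \<sigma> \<subseteq> \<rho> then incidence_sign R \<rho> \<sigma> else 0)"

definition boundary_matrix :: "'a rel \<Rightarrow> 'a set list \<Rightarrow> 'a set list \<Rightarrow> real mat" where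
  "boundary_matrix R xs ys =
     mat (length xs) (length ys) (\<lambda>(i, j). boundary_entry R (xs ! i) (ys ! j))"

text \<open>A summand is nonzero only at a common coface. On the diagonal each coface contributes a
  squared sign, which gives the degree; off the diagonal the only candidate is
  \<open>\<sigma> \<union> \<eta>\<close>, and the exchange identity supplies the minus
  sign.\<close>

lemma upper_laplacian_entry_boundary:
  assumes X: "simplicial_complex V X" and R: "linear_order_on V R"
    and \<sigma>: "\<sigma> \<in> faces X (int r - 1)" and \<eta>: "\<eta> \<in> faces X (int r - 1)"
  shows "upper_laplacian_entry R X r \<sigma> \<eta>
    = (\<Sum>\<rho>\<in>faces X (int r). boundary_entry R \<sigma> \<rho> * boundary_entry R \<eta> \<rho>)"
proof -
  let ?F = "faces X (int r)"
  have sum: "(\<Sum>\<rho>\<in>?F. boundary_entry R \<sigma> \<rho> * boundary_entry R \<eta> \<rho>)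
    = (\<Sum>\<rho>\<in>{\<rho> \<in> ?F. \<sigma> \<subseteq> \<rho> \<and> \<eta> \<subseteq> \<rho>}. incidence_sign R \<rho> \<sigma> * incidence_sign R \<rho> \<eta>)"
    using finite_faces[OF X]
    by (intro sum.mono_neutral_cong_right) (auto simp: boundary_entry_def)
  have finV: "finite V" and XV: "\<And>\<rho>. \<rho> \<in> X \<Longrightarrow> \<rho> \<subseteq> V" using X by (auto simp: simplicial_complex_def)
  have fin: "\<And>\<rho>. \<rho> \<in> X \<Longrightarrow> finite \<rho>" using XV finV finite_subset by blast
  have \<sigma>X: "\<sigma> \<in> X" "card \<sigma> = r" "finite \<sigma>" and \<eta>X: "\<eta> \<in> X" "card \<eta> = r" "finite \<eta>"
    using \<sigma> \<eta> fin by (auto simp: faces_iff_card)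
  show ?thesis
  proof (cases "\<sigma> = \<eta>")
    case True
    then show ?thesis
      unfolding sum by (simp add: upper_laplacian_entry_def r_degree_def incidence_sign_square)
  next
    case False
    have union: "card (\<sigma> \<union> \<eta>) + card (\<sigma> \<inter> \<eta>) = 2 * r"
      using card_Un_Int[of \<sigma> \<eta>] \<sigma>X \<eta>X by simp
    have not_sub: "\<not> \<eta> \<subseteq> \<sigma>" "\<not> \<sigma> \<subseteq> \<eta>"
      using False \<sigma>X \<eta>X card_subset_eq[of \<sigma> \<eta>] card_subset_eq[of \<eta> \<sigma>] by auto
    then have gt: "card (\<sigma> \<union> \<eta>) > r"
      using psubset_card_mono[of "\<sigma> \<union> \<eta>" \<sigma>] \<sigma>X \<eta>X by auto
    \<comment> \<open>The union already has at least \<open>r + 1\<close> elements, so it fills any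
      common coface.\<close>
    have only: "\<rho> = \<sigma> \<union> \<eta>" if "\<rho> \<in> ?F" "\<sigma> \<subseteq> \<rho>" "\<eta> \<subseteq> \<rho>" for \<rho>
    proof -
      have \<rho>: "finite \<rho>" "card \<rho> = Suc r" using that fin by (auto simp: faces_iff_card)
      then have "\<sigma> \<union> \<eta> = \<rho>"
        using that gt by (intro card_seteq) auto
      then show ?thesis by simp
    qed
    show ?thesis
    proof (cases "int (card (\<sigma> \<inter> \<eta>)) = int r - 1 \<and> \<sigma> \<union> \<eta> \<in> X")
      case True
      let ?\<rho> = "\<sigma> \<union> \<eta>"
      have card: "card ?\<rho> = Suc r" and F: "?\<rho> \<in> ?F"
        using True union by (auto simp: faces_iff_card)
      \<comment> \<open>Each of the two facets omits one vertex of the union; these vertices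
        \<open>a\<close> and \<open>b\<close> are the pair for the exchange identity.\<close>
      have "card (?\<rho> - \<sigma>) = 1" "card (?\<rho> - \<eta>) = 1"
        using card \<sigma>X \<eta>X by (simp_all add: card_Diff_subset)
      then obtain a b where a: "?\<rho> - \<sigma> = {a}" and b: "?\<rho> - \<eta> = {b}"
        by (auto simp: card_1_singleton_iff)
      have rem: "\<sigma> = ?\<rho> - {a}" "\<eta> = ?\<rho> - {b}" "\<sigma> \<inter> \<eta> = ?\<rho> - {a, b}" "a \<noteq> b" "a \<in> ?\<rho>" "b \<in> ?\<rho>"
        using a b by blast+
      have "total_on ?\<rho> R"
        using R XV[of ?\<rho>] True unfolding linear_order_on_def total_on_def by blast
      moreover have "antisym R"
        using R by (simp add: linear_order_on_def partial_order_on_def)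
      ultimately have "incidence_sign R ?\<rho> \<sigma> * incidence_sign R ?\<rho> \<eta>
          = - (incidence_sign R \<sigma> (\<sigma> \<inter> \<eta>) * incidence_sign R \<eta> (\<sigma> \<inter> \<eta>))"
        using incidence_sign_exchange[of ?\<rho> R a b] rem \<sigma>X(3) \<eta>X(3) by (metis finite_UnI)
      moreover have "{\<rho> \<in> ?F. \<sigma> \<subseteq> \<rho> \<and> \<eta> \<subseteq> \<rho>} = {?\<rho>}"
        using only F by blast
      ultimately show ?thesis
        unfolding sum using True False by (simp add: upper_laplacian_entry_def)
    next
      case no: False
      \<comment> \<open>A common coface would equal the union, putting it in \<open>X\<close> with
        size \<open>r + 1\<close>; by \<open>union\<close> the intersection would then have size
        \<open>r - 1\<close>, against \<open>no\<close>.\<close>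
      have "\<rho> \<notin> {\<rho> \<in> ?F. \<sigma> \<subseteq> \<rho> \<and> \<eta> \<subseteq> \<rho>}" for \<rho>
      proof
        assume \<rho>: "\<rho> \<in> {\<rho> \<in> ?F. \<sigma> \<subseteq> \<rho> \<and> \<eta> \<subseteq> \<rho>}"
        then have "\<sigma> \<union> \<eta> \<in> X" "card (\<sigma> \<union> \<eta>) = Suc r"
          using only[of \<rho>] by (auto simp: faces_iff_card)
        then show False using no union by auto
      qed
      then have "{\<rho> \<in> ?F. \<sigma> \<subseteq> \<rho> \<and> \<eta> \<subseteq> \<rho>} = {}" by blast
      then show ?thesis
        unfolding sum using no False by (simp add: upper_laplacian_entry_def del: Collect_empty_eq) blast
    qed
  qed
qed

lemma sum_nth_distinct:
  assumes "distinct xs"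
  shows "(\<Sum>i\<in>{0..<length xs}. f (xs ! i)) = sum f (set xs)"
  using assms by (intro sum.reindex_bij_betw bij_betw_nth) auto

lemma upper_laplacian_eq_boundary_mult_transpose:
  assumes X: "simplicial_complex V X" and R: "linear_order_on V R"
    and xs: "set xs = faces X (int r - 1)" and ys: "distinct ys" "set ys = faces X (int r)"
  shows "upper_laplacian R X r xs = boundary_matrix R xs ys * transpose_mat (boundary_matrix R xs ys)"
proof (rule eq_matI)
  fix i j
  assume "i < dim_row (boundary_matrix R xs ys * transpose_mat (boundary_matrix R xs ys))"
    and "j < dim_col (boundary_matrix R xs ys * transpose_mat (boundary_matrix R xs ys))"
  then have ij: "i < length xs" "j < length xs" by (auto simp: boundary_matrix_def)
  have "(boundary_matrix R xs ys * transpose_mat (boundary_matrix R xs ys)) $$ (i, j)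
      = (\<Sum>l\<in>{0..<length ys}. boundary_entry R (xs ! i) (ys ! l) * boundary_entry R (xs ! j) (ys ! l))"
    using ij by (simp add: boundary_matrix_def scalar_prod_def)
  also have "\<dots> = (\<Sum>\<rho>\<in>faces X (int r). boundary_entry R (xs ! i) \<rho> * boundary_entry R (xs ! j) \<rho>)"
    using sum_nth_distinct[OF ys(1), of "\<lambda>\<rho>. boundary_entry R (xs ! i) \<rho> * boundary_entry R (xs ! j) \<rho>"] ys(2)
    by simp
  also have "\<dots> = upper_laplacian_entry R X r (xs ! i) (xs ! j)"
    using ij xs by (intro upper_laplacian_entry_boundary[OF X R, symmetric]) (auto dest: nth_mem)
  finally show "upper_laplacian R X r xs $$ (i, j)
      = (boundary_matrix R xs ys * transpose_mat (boundary_matrix R xs ys)) $$ (i, j)"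
    using ij by (simp add: upper_laplacian_def)
qed (auto simp: upper_laplacian_def boundary_matrix_def)

section \<open>Complexes in which no two simplices share a facet\<close>

text \<open>Closure under inclusion makes every \<open>r\<close>-subset of \<rho> a face, so the
  count is the binomial coefficient of \<open>r + 1\<close> over \<open>r\<close>.\<close>

lemma card_facets:
  assumes X: "simplicial_complex V X" and \<rho>: "\<rho> \<in> faces X (int r)"
  shows "card {\<sigma> \<in> faces X (int r - 1). \<sigma> \<subseteq> \<rho>} = r + 1"
proof -
  have *: "\<rho> \<in> X" "card \<rho> = Suc r" using \<rho> by (auto simp: faces_iff_card)
  then have "finite \<rho>" by (metis card.infinite nat.distinct(1))
  have "{\<sigma> \<in> faces X (int r - 1). \<sigma> \<subseteq> \<rho>} = {\<sigma>. \<sigma> \<subseteq> \<rho> \<and> card \<sigma> = r}"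
    using X *(1) by (auto simp: faces_iff_card simplicial_complex_def)
  then show ?thesis using n_subsets[OF \<open>finite \<rho>\<close>, of r] *(2) by simp
qed

text \<open>A diagonal entry sums the squared signs of \<open>r + 1\<close> facets. An off-diagonal
  entry would need a facet shared by two different \<open>r\<close>-simplices, which
  \<open>unique\<close>, the at-most-one half of the theorem's assumption, excludes.\<close>

lemma transpose_boundary_mult_boundary:
  assumes X: "simplicial_complex V X"
    and unique: "\<And>\<sigma> \<rho> \<rho>'. \<sigma> \<in> faces X (int r - 1) \<Longrightarrow> \<rho> \<in> faces X (int r) \<Longrightarrow> \<rho>' \<in> faces X (int r)
      \<Longrightarrow> \<sigma> \<subseteq> \<rho> \<Longrightarrow> \<sigma> \<subseteq> \<rho>' \<Longrightarrow> \<rho> = \<rho>'"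
    and xs: "distinct xs" "set xs = faces X (int r - 1)"
    and ys: "distinct ys" "set ys = faces X (int r)"
  shows "transpose_mat (boundary_matrix R xs ys) * boundary_matrix R xs ys
    = real (r + 1) \<cdot>\<^sub>m 1\<^sub>m (length ys)"
proof (rule eq_matI)
  fix i j
  assume "i < dim_row (real (r + 1) \<cdot>\<^sub>m 1\<^sub>m (length ys))" "j < dim_col (real (r + 1) \<cdot>\<^sub>m 1\<^sub>m (length ys))"
  then have ij: "i < length ys" "j < length ys" by auto
  then have F: "ys ! i \<in> faces X (int r)" "ys ! j \<in> faces X (int r)" using ys by (auto dest: nth_mem)
  let ?E = "faces X (int r - 1)"
  have "(transpose_mat (boundary_matrix R xs ys) * boundary_matrix R xs ys) $$ (i, j)
      = (\<Sum>l\<in>{0..<length xs}. boundary_entry R (xs ! l) (ys ! i) * boundary_entry R (xs ! l) (ys ! j))"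
    using ij by (simp add: boundary_matrix_def scalar_prod_def)
  also have "\<dots> = (\<Sum>\<sigma>\<in>?E. boundary_entry R \<sigma> (ys ! i) * boundary_entry R \<sigma> (ys ! j))"
    using sum_nth_distinct[OF xs(1), of "\<lambda>\<sigma>. boundary_entry R \<sigma> (ys ! i) * boundary_entry R \<sigma> (ys ! j)"] xs(2)
    by simp
  also have "\<dots> = (if i = j then real (r + 1) else 0)"
  proof (cases "i = j")
    case True
    have "(\<Sum>\<sigma>\<in>?E. boundary_entry R \<sigma> (ys ! j) * boundary_entry R \<sigma> (ys ! j))
        = (\<Sum>\<sigma>\<in>{\<sigma> \<in> ?E. \<sigma> \<subseteq> ys ! j}. 1)"
      using finite_faces[OF X]
      by (intro sum.mono_neutral_cong_right) (auto simp: boundary_entry_def incidence_sign_square)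
    then show ?thesis using True card_facets[OF X F(2)] by simp
  next
    case False
    then have "ys ! i \<noteq> ys ! j" using ys(1) ij by (simp add: nth_eq_iff_index_eq)
    then have "boundary_entry R \<sigma> (ys ! i) * boundary_entry R \<sigma> (ys ! j) = 0" if "\<sigma> \<in> ?E" for \<sigma>
      using unique[OF that F] by (auto simp: boundary_entry_def)
    then have "(\<Sum>\<sigma>\<in>?E. boundary_entry R \<sigma> (ys ! i) * boundary_entry R \<sigma> (ys ! j)) = 0"
      by (intro sum.neutral) blast
    then show ?thesis using False by simp
  qed
  finally show "(transpose_mat (boundary_matrix R xs ys) * boundary_matrix R xs ys) $$ (i, j)
      = (real (r + 1) \<cdot>\<^sub>m 1\<^sub>m (length ys)) $$ (i, j)"
    using ij by simp
qed (auto simp: boundary_matrix_def)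

text \<open>The facet sets of the \<open>r\<close>-simplices partition the
  \<open>(r-1)\<close>-simplices: existence of a coface gives the covering, uniqueness the
  disjointness.\<close>

lemma card_faces_unique_cofacet:
  assumes X: "simplicial_complex V X"
    and unique: "\<forall>\<sigma> \<in> faces X (int r - 1). \<exists>!\<tau>. \<tau> \<in> faces X (int r) \<and> \<sigma> \<subseteq> \<tau>"
  shows "card (faces X (int r - 1)) = (r + 1) * card (faces X (int r))"
proof -
  have "faces X (int r - 1) = (\<Union>\<rho>\<in>faces X (int r). {\<sigma> \<in> faces X (int r - 1). \<sigma> \<subseteq> \<rho>})"
    (is "_ = ?U")
  proof
    show "faces X (int r - 1) \<subseteq> ?U"
    proof
      fix \<sigma>
      assume \<sigma>: "\<sigma> \<in> faces X (int r - 1)"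
      obtain \<rho> where "\<rho> \<in> faces X (int r)" "\<sigma> \<subseteq> \<rho>"
        using ex1_implies_ex[OF bspec[OF unique \<sigma>]] by blast
      with \<sigma> show "\<sigma> \<in> ?U" by blast
    qed
  qed blast
  also have "card \<dots> = (\<Sum>\<rho>\<in>faces X (int r). card {\<sigma> \<in> faces X (int r - 1). \<sigma> \<subseteq> \<rho>})"
  proof (rule card_UN_disjoint)
    show "\<forall>\<rho>\<in>faces X (int r). \<forall>\<rho>'\<in>faces X (int r). \<rho> \<noteq> \<rho>' \<longrightarrow>
      {\<sigma> \<in> faces X (int r - 1). \<sigma> \<subseteq> \<rho>} \<inter> {\<sigma> \<in> faces X (int r - 1). \<sigma> \<subseteq> \<rho>'} = {}"
      using unique by blast
  qed (simp_all add: finite_faces[OF X])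
  also have "\<dots> = (r + 1) * card (faces X (int r))"
    by (simp add: card_facets[OF X])
  finally show ?thesis .
qed

theorem proposition3p5:
  fixes V :: "'a set" and R :: "'a rel" and X :: "'a set set" and r k :: nat
    and xs :: "'a set list"
  assumes "simplicial_complex V X"
    and "linear_order_on V R"
    and "r \<ge> 1"
    and "\<forall>\<sigma> \<in> faces X (int r - 1). \<exists>!\<tau>. \<tau> \<in> faces X (int r) \<and> \<sigma> \<subseteq> \<tau>"
    and "distinct xs" and "set xs = faces X (int r - 1)"
    and "1 \<le> k" and "real k \<le> real (f_number X (int r - 1)) / real (r + 1)"
  shows "(\<Sum>i=1..k. ith_eigenvalue (upper_laplacian R X r xs) i) = real ((r + 1) * k)
       \<and> real ((r + 1) * k) = (\<Sum>i=1..(r + 1) * k. real (degree_seq X r i))"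
proof -
  let ?E = "faces X (int r - 1)" and ?F = "faces X (int r)"
  obtain ys where ys: "distinct ys" "set ys = ?F"
    using finite_distinct_list[OF finite_faces[OF assms(1)]] by blast
  let ?n = "length xs" and ?m = "length ys"
  let ?C = "boundary_matrix R xs ys"
  have n: "?n = card ?E" and m: "?m = card ?F"
    using assms(5,6) ys by (metis distinct_card)+
  have nm: "?n = (r + 1) * ?m"
    unfolding n m by (rule card_faces_unique_cofacet[OF assms(1,4)])
  have "real ((r + 1) * k) \<le> real ?n"
    using assms(8) by (simp add: f_number_def n field_simps)
  then have kn: "(r + 1) * k \<le> ?n" by (simp only: of_nat_le_iff)
  \<comment> \<open>Cancelling \<open>r + 1\<close> shows that the first \<open>k\<close>
    eigenvalues all lie in the block of value \<open>r + 1\<close>, before the zeros.\<close>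
  hence km: "k \<le> ?m" by (simp only: nm mult_le_cancel1)

  have "proots (char_poly (?C * transpose_mat ?C))
      = replicate_mset ?m (real (r + 1)) + replicate_mset (?n - ?m) 0"
  proof (rule proots_char_poly_mult_transpose)
    show "?C \<in> carrier_mat ?n ?m" by (simp add: boundary_matrix_def)
    show "transpose_mat ?C * ?C = real (r + 1) \<cdot>\<^sub>m 1\<^sub>m ?m"
      using assms(4) by (intro transpose_boundary_mult_boundary[OF assms(1) _ assms(5,6) ys]) blast
    show "?m \<le> ?n" using nm by simp
  qed
  then have "ith_eigenvalue (upper_laplacian R X r xs) i = real (r + 1)" if "1 \<le> i" "i \<le> k" for i
    using that km
    by (simp add: ith_eigenvalue_def ith_largest_two_blocks
      upper_laplacian_eq_boundary_mult_transpose[OF assms(1,2,6) ys])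
  then have eig: "(\<Sum>i=1..k. ith_eigenvalue (upper_laplacian R X r xs) i) = real ((r + 1) * k)"
    by (simp add: algebra_simps)

  have deg: "r_degree X r \<sigma> = 1" if "\<sigma> \<in> ?E" for \<sigma>
  proof -
    have "\<exists>!\<tau>. \<tau> \<in> ?F \<and> \<sigma> \<subseteq> \<tau>"
      using assms(4) that by (rule bspec)
    then obtain \<rho> where "\<rho> \<in> ?F \<and> \<sigma> \<subseteq> \<rho>" and "\<And>\<tau>. \<tau> \<in> ?F \<and> \<sigma> \<subseteq> \<tau> \<Longrightarrow> \<tau> = \<rho>"
      by blast
    then have "{\<tau> \<in> ?F. \<sigma> \<subseteq> \<tau>} = {\<rho>}" by blast
    then show ?thesis by (simp add: r_degree_def)
  qed
  have "image_mset (r_degree X r) (mset_set ?E) = image_mset (\<lambda>_. 1) (mset_set ?E)"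
    using finite_faces[OF assms(1)] by (intro image_mset_cong) (simp add: deg)
  \<comment> \<open>The empty second block only fits the degrees to the shape of
    \<open>ith_largest_two_blocks\<close>; \<open>kn\<close> keeps every index up to
    \<open>(r + 1) * k\<close> within the \<open>?n\<close> degrees.\<close>
  also have "\<dots> = replicate_mset ?n 1 + replicate_mset 0 1"
    by (simp add: n image_mset_const_eq)
  finally have "degree_seq X r i = 1" if "1 \<le> i" "i \<le> (r + 1) * k" for i
    using that kn ith_largest_two_blocks[of 1 "1::nat" i ?n 0] by (simp add: degree_seq_def)
  then have "real ((r + 1) * k) = (\<Sum>i=1..(r + 1) * k. real (degree_seq X r i))"
    by simp
  with eig show ?thesis by blast
qed

thm_deps proposition3p5

end
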